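(* Let $V$ and $W$ be hypervector spaces over a field $K$ and let $(T:V\to W,\ f:A\to B)$ be a bipolar fuzzy soft linear transformation. If $(G,B)$ is a bipolar fuzzy soft hypervector space of $W$, then the pre-image $(T,f)^{-1}(G,B)$ is a bipolar fuzzy soft hypervector space of $V$.
   Context: Hypervector space: let $K$ be a field, $(V,+)$ an Abelian group, $P_*(V)$ the set of non-empty subsets of $V$. A hypervector space over $K$ is a quadruple $(V,+,\circ,K)$ with an external hyperoperation $\circ:K\times V\to P_*(V)$ such that for all $a,b\in K$, $x,y\in V$: (i) $a\circ(x+y)\subseteq a\circ x+a\circ y$; (ii) $(a+b)\circ x\subseteq a\circ x+b\circ x$; (iii) $a\circ(b\circ x)=(ab)\circ x$; (iv) $a\circ(-x)=(-a)\circ x=-(a\circ x)$; (v) $x\in 1\circ x$. Here, for subsets, $S+T=\{p+q: p\in S,q\in T\}$, $-S=\{-s:s\in S\}$, and $a\circ(b\circ x)=\bigcup_{t\in b\circ x}a\circ t$. Bipolar fuzzy soft set: a bipolar fuzzy soft set $(F,A)$ over $V$, where $A$ is a set of parameters, assigns to each $e\in A$ a pair of functions $F_e^+:V\to[0,1]$ and $F_e^-:V\to[-1,0]$. Bipolar fuzzy soft hypervector space: $(F,A)$ is a bipolar fuzzy soft hypervector space of $V$ if for all $e\in A$, $x,y\in V$, $a\in K$: (1) $F_e^+(x-y)\ge F_e^+(x)\wedge F_e^+(y)$ and $F_e^-(x-y)\le F_e^-(x)\vee F_e^-(y)$; (2) $\bigwedge_{t\in a\circ x}F_e^+(t)\ge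 F_e^+(x)$ and $\bigvee_{t\in a\circ x}F_e^-(t)\le F_e^-(x)$. Here $\wedge,\vee$ (and $\bigwedge,\bigvee$) denote minimum and maximum (infimum and supremum) of real numbers. Linear transformation: a pair of functions $(T:V\to W,\ f:A\to B)$, where $A,B$ are sets of parameters, is a bipolar fuzzy soft linear transformation if $T(x+y)=T(x)+T(y)$ and $T(a\circ x)\subseteq a\circ T(x)$ for all $x,y\in V$, $a\in K$, where $T(a\circ x)=\{T(t):t\in a\circ x\}$. Pre-image: $(T,f)^{-1}(G,B)=(T^{-1}(G),A)$ is the bipolar fuzzy soft set over $V$ given by $T^{-1}(G)^+_e(x)=G^+_{f(e)}(T(x))$ and $T^{-1}(G)^-_e(x)=G^-_{f(e)}(T(x))$ for all $e\in A$, $x\in V$. *)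

theory Defs
  imports Complex_Main "HOL-Library.Set_Algebras" "HOL-Library.FuncSet"
begin

text \<open>
  The sum of two sets is the Minkowski sum of \<^theory>\<open>HOL-Library.Set_Algebras\<close>. Unary minus on
  sets is the complement in the library, so the set of negatives of \<open>S\<close> is written \<open>uminus ` S\<close>.
\<close>

locale hypervector_space =
  fixes smul :: "'k::field \<Rightarrow> 'v::ab_group_add \<Rightarrow> 'v set"  (infixr \<open>\<odot>\<close> 75)
  assumes smul_nonempty: "a \<odot> x \<noteq> {}"
    and smul_add_right: "a \<odot> (x + y) \<subseteq> a \<odot> x + a \<odot> y"
    and smul_add_left: "(a + b) \<odot> x \<subseteq> a \<odot> x + b \<odot> x"
    and smul_smul: "(\<Union>t\<in>b \<odot> x. a \<odot> t) = (a * b) \<odot> x"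
    and smul_minus_right: "a \<odot> (- x) = (- a) \<odot> x"
    and smul_minus_left: "(- a) \<odot> x = uminus ` (a \<odot> x)"
    and smul_one: "x \<in> 1 \<odot> x"

text \<open>
  A pair \<open>(F, A)\<close>: the parameter set \<open>A\<close> and, for each parameter \<open>e\<close>, the pair of functions
  \<open>F e = (F\<^sub>e\<^sup>+, F\<^sub>e\<^sup>-)\<close>. Only the values of \<open>F\<close> on \<open>A\<close> are meaningful.
\<close>

type_synonym ('p, 'v) bipolar_soft = "('p \<Rightarrow> ('v \<Rightarrow> real) \<times> ('v \<Rightarrow> real)) \<times> 'p set"

abbreviation pos :: "('p \<Rightarrow> ('v \<Rightarrow> real) \<times> ('v \<Rightarrow> real)) \<Rightarrow> 'p \<Rightarrow> 'v \<Rightarrow> real"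
  where "pos F e \<equiv> fst (F e)"

abbreviation neg :: "('p \<Rightarrow> ('v \<Rightarrow> real) \<times> ('v \<Rightarrow> real)) \<Rightarrow> 'p \<Rightarrow> 'v \<Rightarrow> real"
  where "neg F e \<equiv> snd (F e)"

fun bipolar_fuzzy_soft_set :: "('p, 'v) bipolar_soft \<Rightarrow> bool" where
  "bipolar_fuzzy_soft_set (F, A) \<longleftrightarrow>
     (\<forall>e\<in>A. pos F e \<in> UNIV \<rightarrow> {0..1} \<and> neg F e \<in> UNIV \<rightarrow> {-1..0})"

text \<open>
  The infima and suprema below are those of the conditionally complete lattice of reals. They are
  the intended ones because \<open>smul a x\<close> is non-empty in a hypervector space and the membership
  functions are bounded.
\<close>

fun bipolar_fuzzy_soft_hypervector_space ::
    "('k::field \<Rightarrow> 'v::ab_group_add \<Rightarrow> 'v set) \<Rightarrow> ('p, 'v) bipolar_soft \<Rightarrow> bool" where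
  "bipolar_fuzzy_soft_hypervector_space smul (F, A) \<longleftrightarrow>
     bipolar_fuzzy_soft_set (F, A) \<and>
     (\<forall>e\<in>A. \<forall>x y. pos F e (x - y) \<ge> min (pos F e x) (pos F e y) \<and>
                   neg F e (x - y) \<le> max (neg F e x) (neg F e y)) \<and>
     (\<forall>e\<in>A. \<forall>a x. (INF t\<in>smul a x. pos F e t) \<ge> pos F e x \<and>
                   (SUP t\<in>smul a x. neg F e t) \<le> neg F e x)"

definition bipolar_fuzzy_soft_linear_transformation ::
    "('k::field \<Rightarrow> 'v::ab_group_add \<Rightarrow> 'v set) \<Rightarrow> ('k \<Rightarrow> 'w::ab_group_add \<Rightarrow> 'w set) \<Rightarrow>
     'p set \<Rightarrow> 'q set \<Rightarrow> ('v \<Rightarrow> 'w) \<Rightarrow> ('p \<Rightarrow> 'q) \<Rightarrow> bool" where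
  "bipolar_fuzzy_soft_linear_transformation smulV smulW A B T f \<longleftrightarrow>
     f \<in> A \<rightarrow> B \<and>
     (\<forall>x y. T (x + y) = T x + T y) \<and>
     (\<forall>a x. T ` smulV a x \<subseteq> smulW a (T x))"

text \<open>
  The domain \<open>A\<close> of \<open>f\<close> is an explicit argument, since it cannot be recovered from the total
  function \<open>f\<close>.
\<close>

fun soft_preimage ::
    "'p set \<Rightarrow> ('v \<Rightarrow> 'w) \<Rightarrow> ('p \<Rightarrow> 'q) \<Rightarrow> ('q, 'w) bipolar_soft \<Rightarrow> ('p, 'v) bipolar_soft" where
  "soft_preimage A T f (G, B) =
     ((\<lambda>e. (\<lambda>x. pos G (f e) (T x), \<lambda>x. neg G (f e) (T x))), A)"

end

theory Submission
  imports Defs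
begin

text \<open>Each condition on the pre-image at \<open>e\<close> and \<open>x\<close> reduces to the
  condition on \<open>G\<close> at \<open>f e\<close> and \<open>T x\<close>. The range conditions
  carry over pointwise, and the difference conditions because \<open>T\<close> preserves
  differences. For the hyperoperation, \<open>T\<close> maps \<open>smulV a x\<close> into
  \<open>smulW a (T x)\<close>, so the infimum of the positive part is taken over a smaller set and
  can only grow, while the supremum of the negative part can only shrink; the bounds assumed for
  \<open>G\<close> then finish.\<close>

theorem theorem5p4:
  fixes smulV :: "'k::field \<Rightarrow> 'v::ab_group_add \<Rightarrow> 'v set"
    and smulW :: "'k \<Rightarrow> 'w::ab_group_add \<Rightarrow> 'w set"
    and T :: "'v \<Rightarrow> 'w" and f :: "'p \<Rightarrow> 'q"
    and A :: "'p set" and B :: "'q set"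
    and G :: "'q \<Rightarrow> ('w \<Rightarrow> real) \<times> ('w \<Rightarrow> real)"
  assumes "hypervector_space smulV"
    and "hypervector_space smulW"
    and "bipolar_fuzzy_soft_linear_transformation smulV smulW A B T f"
    and "bipolar_fuzzy_soft_hypervector_space smulW (G, B)"
  shows "bipolar_fuzzy_soft_hypervector_space smulV (soft_preimage A T f (G, B))"
proof -
  interpret V: hypervector_space smulV by fact
  have f: "f e \<in> B" if "e \<in> A" for e
    using assms(3) that by (auto simp: bipolar_fuzzy_soft_linear_transformation_def)
  \<comment> \<open>The hypothesis speaks of sums only; as an \<open>additive\<close> map,
    \<open>T\<close> gets T(x - y) = T x - T y from \<open>additive.diff\<close>.\<close>
  have T: "additive T" and T_smul: "T ` smulV a x \<subseteq> smulW a (T x)" for a x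
    using assms(3) by (auto simp: bipolar_fuzzy_soft_linear_transformation_def additive_def)
  have range: "pos G e w \<in> {0..1}" "neg G e w \<in> {-1..0}" if "e \<in> B" for e w
    using assms(4) that by (auto simp: Pi_iff)
  have diff: "min (pos G e u) (pos G e w) \<le> pos G e (u - w)"
    "neg G e (u - w) \<le> max (neg G e u) (neg G e w)" if "e \<in> B" for e u w
    using assms(4) that by auto
  have smul: "pos G e w \<le> (INF t\<in>smulW a w. pos G e t)"
    "(SUP t\<in>smulW a w. neg G e t) \<le> neg G e w" if "e \<in> B" for e a w
    using assms(4) that by auto
  have "pos G (f e) (T x) \<le> (INF t\<in>smulV a x. pos G (f e) (T t))" if "e \<in> A" for e a x
  proof -
    \<comment> \<open>Infima of reals are monotone only conditionally: the larger set must be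
      bounded below, here by the left end of [0,1], and the smaller one non-empty, here by
      \<open>V.smul_nonempty\<close>.\<close>
    have "bdd_below (pos G (f e) ` smulW a (T x))"
      using range(1)[OF f[OF that]] by (intro bdd_belowI2[where m = 0]) auto
    then have "(INF t\<in>smulW a (T x). pos G (f e) t) \<le> (INF t\<in>T ` smulV a x. pos G (f e) t)"
      using V.smul_nonempty T_smul by (intro cINF_superset_mono) auto
    with smul(1)[OF f[OF that], of "T x" a] show ?thesis
      by (simp add: image_image)
  qed
  moreover have "(SUP t\<in>smulV a x. neg G (f e) (T t)) \<le> neg G (f e) (T x)" if "e \<in> A" for e a x
  proof -
    \<comment> \<open>Dually, the bound 0 is the right end of [-1,0].\<close>
    have "bdd_above (neg G (f e) ` smulW a (T x))"
      using range(2)[OF f[OF that]] by (intro bdd_aboveI2[where M = 0]) auto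
    then have "(SUP t\<in>T ` smulV a x. neg G (f e) t) \<le> (SUP t\<in>smulW a (T x). neg G (f e) t)"
      using V.smul_nonempty T_smul by (intro cSUP_subset_mono) auto
    with smul(2)[OF f[OF that], of a "T x"] show ?thesis
      by (simp add: image_image)
  qed
  ultimately show ?thesis
    using range f diff by (simp add: Pi_iff additive.diff[OF T])
qed

end
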